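(* A stick is broken at random into three pieces of lengths $\alpha,\beta,\gamma$. The probability that there exists a triangle whose three medians have lengths $\alpha,\beta,\gamma$ is $\frac14$. Moreover, the probability that such a triangle exists and is acute equals $$\frac13-\frac59\ln\left(\frac85\right)\approx 0.0722202059.$$
   Context: Probabilistic model (broken stick): the stick has length $\sqrt3$. Let $T$ be the equilateral triangle with vertices $(1,0)$, $(-1,0)$, $(0,\sqrt3)$ (side length $2$, area $\sqrt3$). A point $Q=(x,y)$ is chosen uniformly at random (with respect to area) inside $T$, and the three pieces are the distances from $Q$ to the three sides of $T$: $$\alpha=y,\qquad \beta=\frac{\sqrt3(1+x)-y}{2},\qquad \gamma=\frac{\sqrt3(1-x)-y}{2},$$ so that $\alpha+\beta+\gamma=\sqrt3$. The probability of an event described by a region $\mathcal R\subseteq T$ is $\mathrm{Area}(\mathcal R)/\sqrt3$. Triangles are non-degenerate. *)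

theory Defs
  imports "HOL-Probability.Probability"
begin

type_synonym point = "real \<times> real"

definition triangle :: "point \<Rightarrow> point \<Rightarrow> point \<Rightarrow> bool" where
  "triangle A B C \<longleftrightarrow> \<not> collinear {A, B, C}"

definition median :: "point \<Rightarrow> point \<Rightarrow> point \<Rightarrow> real" where
  "median A B C = dist A (midpoint B C)"

text \<open>The angle at the middle argument, as in \<open>\<angle>ABC\<close>.\<close>

definition angle :: "point \<Rightarrow> point \<Rightarrow> point \<Rightarrow> real" where
  "angle A B C = arccos (((A - B) \<bullet> (C - B)) / (norm (A - B) * norm (C - B)))"

definition acute :: "point \<Rightarrow> point \<Rightarrow> point \<Rightarrow> bool" where
  "acute A B C \<longleftrightarrow> angle B A C < pi / 2 \<and> angle A B C < pi / 2 \<and> angle A C B < pi / 2"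

text \<open>By symmetry of the existential quantifier, it is immaterial which vertex each of the
  three lengths is assigned to.\<close>

definition median_lengths :: "point \<Rightarrow> point \<Rightarrow> point \<Rightarrow> real \<Rightarrow> real \<Rightarrow> real \<Rightarrow> bool" where
  "median_lengths A B C a b c \<longleftrightarrow> median A B C = a \<and> median B C A = b \<and> median C A B = c"

definition stick_triangle :: "point set" where
  "stick_triangle = convex hull {(1, 0), (-1, 0), (0, sqrt 3)}"

definition broken_stick :: "point measure" where
  "broken_stick = uniform_measure lborel stick_triangle"

text \<open>The three pieces are the distances to the sides; inside the triangle they are given by
  the explicit formulas \<open>alpha_eq\<close>, \<open>beta_eq\<close>, \<open>gamma_eq\<close> below.\<close>

definition alpha :: "point \<Rightarrow> real" where
  "alpha Q = infdist Q (closed_segment (-1, 0) (1, 0))"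

definition beta :: "point \<Rightarrow> real" where
  "beta Q = infdist Q (closed_segment (-1, 0) (0, sqrt 3))"

definition gamma :: "point \<Rightarrow> real" where
  "gamma Q = infdist Q (closed_segment (1, 0) (0, sqrt 3))"

lemma stick_triangle_bounds:
  assumes "(x, y) \<in> stick_triangle"
  shows "0 \<le> y" "y \<le> sqrt 3 * (1 + x)" "y \<le> sqrt 3 * (1 - x)"
proof -
  obtain u v w where uvw: "0 \<le> u" "0 \<le> v" "0 \<le> w" "u + v + w = 1"
    and xy: "x = u - v" "y = w * sqrt 3"
    using assms by (auto simp: stick_triangle_def convex_hull_3)
  show "0 \<le> y" using uvw xy by simp
  have "w \<le> 1 + x" "w \<le> 1 - x" using uvw xy by auto
  then show "y \<le> sqrt 3 * (1 + x)" "y \<le> sqrt 3 * (1 - x)"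
    by (simp_all add: xy(2) mult.commute mult_left_mono)
qed

lemma infdist_eqI:
  fixes Q F n :: point
  assumes "F \<in> S" "norm n = 1" "Q - F = d *\<^sub>R n" "0 \<le> d"
    and orth: "\<And>P. P \<in> S \<Longrightarrow> n \<bullet> P = n \<bullet> F"
  shows "infdist Q S = d"
proof (rule antisym)
  have "dist Q F = d" using assms by (simp add: dist_norm)
  then show "infdist Q S \<le> d" using infdist_le[OF \<open>F \<in> S\<close>, of Q] by simp
  have "d \<le> dist Q P" if "P \<in> S" for P
  proof -
    have "n \<bullet> n = 1" using assms(2) by (simp add: norm_eq_1)
    then have "n \<bullet> (Q - F) = d" using assms(3) by simp
    then have "n \<bullet> (Q - P) = d" using orth[OF that] by (simp add: inner_diff_right)
    then show ?thesis using norm_cauchy_schwarz[of n "Q - P"] assms(2) by (simp add: dist_norm)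
  qed
  then show "d \<le> infdist Q S"
    using \<open>F \<in> S\<close> cINF_greatest[of S d "dist Q"] by (auto simp: infdist_def)
qed

lemma alpha_eq:
  assumes "(x, y) \<in> stick_triangle"
  shows "alpha (x, y) = y"
proof -
  note b = stick_triangle_bounds[OF assms]
  have "0 \<le> sqrt 3 * (1 + x)" "0 \<le> sqrt 3 * (1 - x)" using b by linarith+
  then have x: "-1 \<le> x" "x \<le> 1" by (simp_all add: zero_le_mult_iff)
  show ?thesis unfolding alpha_def
  proof (rule infdist_eqI[where F = "(x, 0)" and n = "(0, 1)"])
    show "(x, 0) \<in> closed_segment (-1, 0) (1::real, 0::real)"
      unfolding in_segment using x by (intro exI[of _ "(x + 1) / 2"]) (auto simp: field_simps)
  qed (use b in \<open>auto simp: in_segment norm_Pair\<close>)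
qed

lemma slanted_bound:
  assumes "(x, y) \<in> stick_triangle"
  shows "0 \<le> 1 + x + sqrt 3 * y" "1 + x + sqrt 3 * y \<le> 4"
    "0 \<le> 1 - x + sqrt 3 * y" "1 - x + sqrt 3 * y \<le> 4"
proof -
  note b = stick_triangle_bounds[OF assms]
  have "0 \<le> sqrt 3 * (1 + x)" "0 \<le> sqrt 3 * (1 - x)" using b by linarith+
  then have x: "-1 \<le> x" "x \<le> 1" by (simp_all add: zero_le_mult_iff)
  have y: "0 \<le> sqrt 3 * y" using b by simp
  have "sqrt 3 * y \<le> sqrt 3 * (sqrt 3 * (1 + x))" "sqrt 3 * y \<le> sqrt 3 * (sqrt 3 * (1 - x))"
    using b by simp_all
  then have "sqrt 3 * y \<le> 3 * (1 + x)" "sqrt 3 * y \<le> 3 * (1 - x)"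
    by (simp_all add: mult.assoc[symmetric])
  with x y show "0 \<le> 1 + x + sqrt 3 * y" "1 + x + sqrt 3 * y \<le> 4"
    "0 \<le> 1 - x + sqrt 3 * y" "1 - x + sqrt 3 * y \<le> 4" by auto
qed

lemma beta_eq:
  assumes "(x, y) \<in> stick_triangle"
  shows "beta (x, y) = (sqrt 3 * (1 + x) - y) / 2"
proof -
  note b = stick_triangle_bounds[OF assms] and s = slanted_bound[OF assms]
  define t where "t = (1 + x + sqrt 3 * y) / 4"
  show ?thesis unfolding beta_def
  proof (rule infdist_eqI[where F = "(t - 1, t * sqrt 3)" and n = "(sqrt 3 / 2, - 1 / 2)"])
    show "(t - 1, t * sqrt 3) \<in> closed_segment (-1, 0) (0, sqrt 3)"
      unfolding in_segment using s by (intro exI[of _ t]) (auto simp: t_def)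
  qed (use b in \<open>auto simp: in_segment norm_Pair t_def power_divide field_simps\<close>)
qed

lemma gamma_eq:
  assumes "(x, y) \<in> stick_triangle"
  shows "gamma (x, y) = (sqrt 3 * (1 - x) - y) / 2"
proof -
  note b = stick_triangle_bounds[OF assms] and s = slanted_bound[OF assms]
  define t where "t = (1 - x + sqrt 3 * y) / 4"
  show ?thesis unfolding gamma_def
  proof (rule infdist_eqI[where F = "(1 - t, t * sqrt 3)" and n = "(- sqrt 3 / 2, - 1 / 2)"])
    show "(1 - t, t * sqrt 3) \<in> closed_segment (1, 0) (0, sqrt 3)"
      unfolding in_segment using s by (intro exI[of _ t]) (auto simp: t_def)
  qed (use b in \<open>auto simp: in_segment norm_Pair t_def power_divide field_simps\<close>)
qed

end

theory Submission
  imports Defs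
begin

text \<open>
  Let \<open>a\<close>, \<open>b\<close>, \<open>c\<close> be the medians of \<open>ABC\<close>. As vectors they sum to zero, so they are the
  sides of a (possibly degenerate) triangle, and its squared area is a fixed multiple of that of
  \<open>ABC\<close>. Hence \<open>a\<close>, \<open>b\<close>, \<open>c\<close> are the medians of a non-degenerate triangle exactly when they
  satisfy the strict triangle inequalities (\<open>triangle_iff_medians\<close>, \<open>medians_exist\<close>). Moreover
  the inner product of the two sides meeting at the vertex of the median \<open>a\<close> is
  \<open>2/9 (5a\<^sup>2 - b\<^sup>2 - c\<^sup>2)\<close>, so acuteness means \<open>b\<^sup>2 + c\<^sup>2 < 5a\<^sup>2\<close> and its cyclic variants
  (\<open>acute_iff_medians\<close>), and these three inequalities already force the triangle inequalities
  (\<open>acute_medians_imp_triangle\<close>).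

  In the stick triangle, whose area is \<open>\<surd>3\<close>, the strict triangle inequalities cut out the medial
  triangle, a quarter of the area. The acute region splits, according to which piece is the
  shortest, into three parts that exchanging the pieces carries onto each other up to null sets.
  The part where \<open>\<alpha> = y\<close> is shortest has a simple shape: only \<open>\<beta>\<^sup>2 + \<gamma>\<^sup>2 < 5\<alpha>\<^sup>2\<close> matters there, and
  completing the square turns it into \<open>\<surd>(x\<^sup>2 + 10/9) < \<surd>3 y + 1/3\<close>, while \<open>\<alpha> \<le> \<beta>, \<gamma>\<close> says
  \<open>\<surd>3 y \<le> 1 - |x|\<close>. The two graphs meet at \<open>|x| = 1/4\<close>, so this part has area
  \<open>1/\<surd>3 \<integral> (4/3 - |x| - \<surd>(x\<^sup>2 + 10/9)) dx\<close> over \<open>[-1/4, 1/4]\<close>, which is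
  \<open>(1/3 - 5/9 ln (8/5))/\<surd>3\<close> (\<open>emeasure_min_piece_region\<close>). Three such parts divided by \<open>\<surd>3\<close> give the
  stated probability.
\<close>

section \<open>Triangles and their medians\<close>

lemma median_commute: "median A B C = median A C B"
  by (simp add: median_def midpoint_sym)

text \<open>Everything about the medians is read off from the Gram matrix of the two side vectors at
  \<open>B\<close>; the next two lemmas express two medians in it, and exchanging \<open>A\<close> and \<open>C\<close> in
  the first gives the third median.\<close>

lemma median_square_first:
  "(median A B C)\<^sup>2 = (A - B) \<bullet> (A - B) - (A - B) \<bullet> (C - B) + (C - B) \<bullet> (C - B) / 4"
proof -
  have eq: "A - midpoint B C = (A - B) - (1 / 2) *\<^sub>R (C - B)"
    by (simp add: midpoint_def prod_eq_iff field_simps)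
  show ?thesis
    unfolding median_def dist_norm power2_norm_eq_inner eq inner_diff_left[of "A - B"]
      inner_diff_right[of _ "A - B"]
    by (simp add: inner_commute[of "C - B" "A - B"])
qed

lemma median_square_second:
  "(median B C A)\<^sup>2 = ((A - B) \<bullet> (A - B) + 2 * ((A - B) \<bullet> (C - B)) + (C - B) \<bullet> (C - B)) / 4"
proof -
  have "B - midpoint C A = - (1 / 2) *\<^sub>R ((A - B) + (C - B))"
    by (simp add: midpoint_def prod_eq_iff field_simps)
  then have "(median B C A)\<^sup>2 = 1 / 4 * (((A - B) + (C - B)) \<bullet> ((A - B) + (C - B)))"
    unfolding median_def dist_norm power2_norm_eq_inner by (simp only: inner_scaleR)
  then show ?thesis
    unfolding inner_add_left inner_add_right by (simp add: inner_commute[of "C - B" "A - B"])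
qed

lemma inner_sides_eq_medians:
  "(A - B) \<bullet> (C - B) = 2 / 9 * (5 * (median B C A)\<^sup>2 - (median A B C)\<^sup>2 - (median C A B)\<^sup>2)"
proof -
  have "(median C A B)\<^sup>2 = (C - B) \<bullet> (C - B) - (A - B) \<bullet> (C - B) + (A - B) \<bullet> (A - B) / 4"
    using median_square_first[of C B A] by (simp add: median_commute inner_commute)
  then show ?thesis
    unfolding median_square_first[of A B C] median_square_second[of B C A] by (simp add: field_simps)
qed

text \<open>Heron's formula for the triangle whose sides are the medians: two of the median vectors
  arise from the side vectors at \<open>B\<close> by a linear map with determinant of modulus \<open>3/4\<close>, so the
  Gram determinant of the sides is \<open>16/9\<close> times that of the medians, and the latter is a quarter
  of Heron's product.\<close>

lemma gram_sides_eq_heron_medians: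
  fixes A B C :: point
  defines "a \<equiv> median A B C" and "b \<equiv> median B C A" and "c \<equiv> median C A B"
  shows "(norm (A - B) * norm (C - B))\<^sup>2 - ((A - B) \<bullet> (C - B))\<^sup>2
    = 4 / 9 * ((a + b + c) * (b + c - a) * (c + a - b) * (a + b - c))"
proof -
  define U V D where "U = (A - B) \<bullet> (A - B)" and "V = (C - B) \<bullet> (C - B)"
    and "D = (A - B) \<bullet> (C - B)"
  have a: "a\<^sup>2 = U - D + V / 4"
    by (simp add: a_def U_def V_def D_def median_square_first)
  have b: "b\<^sup>2 = (U + 2 * D + V) / 4"
    by (simp add: b_def U_def V_def D_def median_square_second)
  have c: "c\<^sup>2 = V - D + U / 4"
    using median_square_first[of C B A]
    by (simp add: c_def U_def V_def D_def median_commute inner_commute)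
  have "(a + b + c) * (b + c - a) * (c + a - b) * (a + b - c)
      = 4 * a\<^sup>2 * b\<^sup>2 - (a\<^sup>2 + b\<^sup>2 - c\<^sup>2)\<^sup>2"
    by (simp add: power2_eq_square algebra_simps)
  also have "\<dots> = 9 / 4 * (U * V - D\<^sup>2)"
    unfolding a b c by (simp add: power2_eq_square field_simps)
  finally show ?thesis
    by (simp add: U_def V_def D_def power_mult_distrib power2_norm_eq_inner)
qed

text \<open>The three median vectors sum to zero.\<close>

lemma median_triangle_inequality: "median A B C \<le> median B C A + median C A B"
proof -
  have "A - midpoint B C = - ((B - midpoint C A) + (C - midpoint A B))"
    by (simp add: midpoint_def prod_eq_iff field_simps)
  then have "norm (A - midpoint B C) = norm ((B - midpoint C A) + (C - midpoint A B))"
    by (simp only: norm_minus_cancel)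
  then show ?thesis
    unfolding median_def dist_norm by (simp add: norm_triangle_ineq)
qed

text \<open>Non-collinearity is positivity of the Gram determinant, which is Heron's product of factors
  already known to be nonnegative.\<close>

lemma triangle_iff_medians:
  assumes "median_lengths A B C a b c"
  shows "triangle A B C \<longleftrightarrow> a < b + c \<and> b < c + a \<and> c < a + b"
proof -
  have abc: "a = median A B C" "b = median B C A" "c = median C A B"
    using assms by (auto simp: median_lengths_def)
  have nonneg: "0 \<le> a" "0 \<le> b" "0 \<le> c"
    by (auto simp: abc median_def)
  have weak: "a \<le> b + c" "b \<le> c + a" "c \<le> a + b"
    unfolding abc by (rule median_triangle_inequality)+
  have "collinear {A, B, C} \<longleftrightarrow> \<bar>(A - B) \<bullet> (C - B)\<bar> = norm (A - B) * norm (C - B)"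
    using norm_cauchy_schwarz_equal[of "A - B" "C - B"] by (simp add: collinear_3)
  also have "\<dots> \<longleftrightarrow> (norm (A - B) * norm (C - B))\<^sup>2 - ((A - B) \<bullet> (C - B))\<^sup>2 = 0"
    using power2_eq_iff_nonneg[of "\<bar>(A - B) \<bullet> (C - B)\<bar>" "norm (A - B) * norm (C - B)"] by auto
  also have "\<dots> \<longleftrightarrow> (a + b + c) * (b + c - a) * (c + a - b) * (a + b - c) = 0"
    unfolding gram_sides_eq_heron_medians abc by simp
  finally show ?thesis
    unfolding triangle_def using nonneg weak by auto
qed

text \<open>Start from a triangle with sides \<open>a\<close>, \<open>b\<close>, \<open>c\<close>, read as vectors \<open>(a, 0)\<close>, \<open>(m, n)\<close> and
  minus their sum. Two thirds of these vectors, drawn from the origin as centroid, are the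
  vertices sought.\<close>

lemma medians_exist:
  assumes "a < b + c" "b < c + a" "c < a + b"
  shows "\<exists>A B C. median_lengths A B C a b c"
proof -
  have pos: "0 < a" "0 < b" "0 < c"
    using assms by auto
  \<comment> \<open>\<open>m\<close> and \<open>n\<close> solve \<open>m\<^sup>2 + n\<^sup>2 = b\<^sup>2\<close> and \<open>(a + m)\<^sup>2 + n\<^sup>2 = c\<^sup>2\<close>; Heron's product makes \<open>n\<close> real.\<close>
  define m where "m = (c\<^sup>2 - a\<^sup>2 - b\<^sup>2) / (2 * a)"
  define n where "n = sqrt (b\<^sup>2 - m\<^sup>2)"
  have "0 \<le> (a + b + c) * (b + c - a) * (c + a - b) * (a + b - c)"
    using assms pos by (intro mult_nonneg_nonneg) auto
  also have "\<dots> = (2 * a)\<^sup>2 * (b\<^sup>2 - m\<^sup>2)"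
  proof -
    have "2 * a * m = c\<^sup>2 - a\<^sup>2 - b\<^sup>2"
      using pos by (simp add: m_def)
    then have "(2 * a)\<^sup>2 * (b\<^sup>2 - m\<^sup>2) = (2 * a * b)\<^sup>2 - (c\<^sup>2 - a\<^sup>2 - b\<^sup>2)\<^sup>2"
      by (simp add: right_diff_distrib power_mult_distrib flip: \<open>2 * a * m = _\<close>)
    then show ?thesis
      by (simp add: power2_eq_square algebra_simps)
  qed
  finally have "0 \<le> b\<^sup>2 - m\<^sup>2"
    using pos by (simp add: zero_le_mult_iff)
  then have n: "m\<^sup>2 + n\<^sup>2 = b\<^sup>2"
    by (simp add: n_def)
  have am: "(a + m)\<^sup>2 + n\<^sup>2 = c\<^sup>2"
  proof -
    have "(a + m)\<^sup>2 + n\<^sup>2 = a\<^sup>2 + 2 * a * m + (m\<^sup>2 + n\<^sup>2)"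
      by (simp add: power2_eq_square algebra_simps)
    then show ?thesis
      unfolding n using pos by (simp add: m_def)
  qed
  define A B C :: point
    where "A = (2 / 3 * a, 0)" and "B = (2 / 3 * m, 2 / 3 * n)"
      and "C = (- (2 / 3 * (a + m)), - (2 / 3 * n))"
  have "A - midpoint B C = (a, 0)" "B - midpoint C A = (m, n)"
    "C - midpoint A B = (- (a + m), - n)"
    by (simp_all add: A_def B_def C_def midpoint_def field_simps)
  moreover have "norm (- (a + m), - n) = c"
    using pos by (simp add: norm_Pair am del: minus_add_distrib)
  ultimately have "median_lengths A B C a b c"
    using pos by (simp add: median_lengths_def median_def dist_norm norm_Pair n)
  then show ?thesis
    by blast
qed

lemma angle_lt_pi_half_iff:
  assumes "triangle A B C"
  shows "angle A B C < pi / 2 \<longleftrightarrow> 0 < (A - B) \<bullet> (C - B)"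
proof -
  have "A \<noteq> B" "C \<noteq> B"
    using assms by (auto simp: triangle_def insert_commute)
  then have pos: "0 < norm (A - B) * norm (C - B)"
    by simp
  define t where "t = ((A - B) \<bullet> (C - B)) / (norm (A - B) * norm (C - B))"
  have "\<bar>t\<bar> \<le> 1"
    using pos Cauchy_Schwarz_ineq2[of "A - B" "C - B"] by (simp add: t_def abs_mult)
  then have "arccos t < arccos 0 \<longleftrightarrow> 0 < t"
    by (subst arccos_less_mono) auto
  then show ?thesis
    using pos by (simp add: angle_def t_def zero_less_divide_iff)
qed

lemma acute_iff_medians:
  assumes "triangle A B C" "median_lengths A B C a b c"
  shows "acute A B C \<longleftrightarrow>
    b\<^sup>2 + c\<^sup>2 < 5 * a\<^sup>2 \<and> c\<^sup>2 + a\<^sup>2 < 5 * b\<^sup>2 \<and> a\<^sup>2 + b\<^sup>2 < 5 * c\<^sup>2"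
proof -
  have "triangle B A C" "triangle A C B"
    using assms(1) by (simp_all add: triangle_def insert_commute)
  with assms have "acute A B C \<longleftrightarrow> 0 < 2 / 9 * (5 * a\<^sup>2 - b\<^sup>2 - c\<^sup>2) \<and>
      0 < 2 / 9 * (5 * b\<^sup>2 - a\<^sup>2 - c\<^sup>2) \<and> 0 < 2 / 9 * (5 * c\<^sup>2 - a\<^sup>2 - b\<^sup>2)"
    unfolding acute_def median_lengths_def
    by (auto simp only: angle_lt_pi_half_iff inner_sides_eq_medians
        median_commute[of A C B] median_commute[of B A C] median_commute[of C B A])
  then show ?thesis
    by (auto simp: algebra_simps)
qed

text \<open>If \<open>a \<ge> b + c\<close> with, say, \<open>b \<ge> c\<close>, then \<open>a\<^sup>2 + b\<^sup>2 \<ge> 2b\<^sup>2 + 2bc + c\<^sup>2 \<ge> 5c\<^sup>2\<close>.\<close>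

lemma acute_medians_imp_triangle:
  fixes a b c :: real
  assumes "0 \<le> a" "0 \<le> b" "0 \<le> c"
    and "c\<^sup>2 + a\<^sup>2 < 5 * b\<^sup>2" "a\<^sup>2 + b\<^sup>2 < 5 * c\<^sup>2"
  shows "a < b + c"
proof (rule ccontr)
  assume "\<not> a < b + c"
  then have "(b + c)\<^sup>2 \<le> a\<^sup>2"
    using assms by (intro power_mono) auto
  then have "2 * b\<^sup>2 + 2 * (b * c) < 4 * c\<^sup>2" "2 * c\<^sup>2 + 2 * (b * c) < 4 * b\<^sup>2"
    using assms by (auto simp: power2_eq_square algebra_simps)
  moreover have "b\<^sup>2 \<le> b * c \<and> b * c \<le> c\<^sup>2 \<or> c\<^sup>2 \<le> b * c \<and> b * c \<le> b\<^sup>2"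
    using assms by (cases "b \<le> c") (auto simp: power2_eq_square intro: mult_left_mono mult_right_mono)
  ultimately show False
    by linarith
qed

section \<open>Planar areas by slicing\<close>

lemma sets_borel_pair:
  fixes A :: "(real \<times> real) set"
  shows "A \<in> sets borel \<Longrightarrow> A \<in> sets (borel \<Otimes>\<^sub>M borel)"
  by (subst borel_prod)

text \<open>Fubini and the fundamental theorem of calculus. The set is only sandwiched between the open
  and the closed region because the end points of a slice have measure zero; one lemma thus serves sets
  given by any mixture of strict and weak inequalities.\<close>

lemma emeasure_between_graphs:
  fixes f g F :: "real \<Rightarrow> real"
  assumes S[measurable]: "S \<in> sets borel"
    and sub: "{(x, y). f x < y \<and> y < g x} \<subseteq> S" "S \<subseteq> {(x, y). f x \<le> y \<and> y \<le> g x}"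
    and [measurable]: "f \<in> borel_measurable borel" "g \<in> borel_measurable borel"
    and "a \<le> b"
    and inside: "\<And>x. a \<le> x \<Longrightarrow> x \<le> b \<Longrightarrow> f x \<le> g x"
    and outside: "\<And>x. x < a \<or> b < x \<Longrightarrow> g x \<le> f x"
    and deriv: "\<And>x. a \<le> x \<Longrightarrow> x \<le> b \<Longrightarrow> (F has_real_derivative g x - f x) (at x)"
  shows "emeasure lborel S = ennreal (F b - F a)"
proof -
  \<comment> \<open>Outside \<open>{a..b}\<close> the difference \<open>g x - f x\<close> is nonpositive, so \<open>ennreal\<close> truncates it to 0.\<close>
  have slice: "emeasure lborel (Pair x -` S) = ennreal (g x - f x) * indicator {a..b} x" for x
  proof -
    have meas: "Pair x -` S \<in> sets lborel"
      using sets_Pair1[OF sets_borel_pair[OF S]] by simp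
    have "emeasure lborel (Pair x -` S) = ennreal (g x - f x)"
    proof (rule antisym)
      have "emeasure lborel (Pair x -` S) \<le> emeasure lborel {f x..g x}"
        using sub by (intro emeasure_mono) auto
      then show "emeasure lborel (Pair x -` S) \<le> ennreal (g x - f x)"
        by (auto simp: emeasure_lborel_Icc_eq split: if_splits)
      have "emeasure lborel {f x<..<g x} \<le> emeasure lborel (Pair x -` S)"
        using sub meas by (intro emeasure_mono) auto
      then show "ennreal (g x - f x) \<le> emeasure lborel (Pair x -` S)"
        by (cases "f x \<le> g x") (auto simp: ennreal_neg)
    qed
    then show ?thesis
      using outside[of x] by (auto simp: indicator_def ennreal_neg)
  qed
  have "emeasure lborel S = (\<integral>\<^sup>+x. emeasure lborel (Pair x -` S) \<partial>lborel)"
    unfolding lborel_prod[symmetric]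
    by (rule lborel.emeasure_pair_measure_alt) (use assms sets_borel_pair in simp)
  also have "\<dots> = ennreal (F b - F a)"
    unfolding slice by (rule nn_integral_FTC_Icc) (use assms in auto)
  finally show ?thesis .
qed

text \<open>The map \<open>(x, y) \<mapsto> (y, t y + c x)\<close> scales areas by \<open>\<bar>c\<bar>\<close>: for fixed \<open>y\<close> it is an affine map
  of the line.\<close>

lemma emeasure_shear:
  fixes c :: real and t :: "real \<Rightarrow> real"
  assumes A[measurable]: "A \<in> sets borel" and [measurable]: "t \<in> borel_measurable borel" and "c \<noteq> 0"
  shows "emeasure lborel A = ennreal \<bar>c\<bar> * emeasure lborel {(x, y). (y, t y + c * x) \<in> A}"
proof -
  have A'[measurable]: "A \<in> sets (borel \<Otimes>\<^sub>M borel)"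
    using A by (rule sets_borel_pair)
  have B: "{(x, y). (y, t y + c * x) \<in> A} \<in> sets (lborel \<Otimes>\<^sub>M lborel)"
  proof -
    have "(\<lambda>(x, y). (y, t y + c * x)) -` A \<inter> space (borel \<Otimes>\<^sub>M borel) \<in> sets (borel \<Otimes>\<^sub>M borel)"
      by (rule measurable_sets) measurable
    also have "(\<lambda>(x, y). (y, t y + c * x)) -` A \<inter> space (borel \<Otimes>\<^sub>M borel) = {(x, y). (y, t y + c * x) \<in> A}"
      by (auto simp: space_pair_measure)
    finally show ?thesis by simp
  qed
  have slice: "emeasure lborel (Pair y -` A)
      = ennreal \<bar>c\<bar> * emeasure lborel ((\<lambda>x. (x, y)) -` {(x, y). (y, t y + c * x) \<in> A})" for y
  proof -
    have [measurable]: "Pair y -` A \<in> sets borel"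
      using A' by (rule sets_Pair1)
    have "emeasure lborel (Pair y -` A)
        = emeasure (density (distr lborel borel (\<lambda>x. t y + c * x)) (\<lambda>_. ennreal \<bar>c\<bar>)) (Pair y -` A)"
      using lborel_real_affine[OF \<open>c \<noteq> 0\<close>, of "t y"] by simp
    also have "\<dots> = ennreal \<bar>c\<bar> * emeasure lborel ((\<lambda>x. t y + c * x) -` Pair y -` A)"
      by (simp add: emeasure_density_const emeasure_distr)
    finally show ?thesis
      by (simp add: vimage_def)
  qed
  have "emeasure lborel A = (\<integral>\<^sup>+y. emeasure lborel (Pair y -` A) \<partial>lborel)"
    unfolding lborel_prod[symmetric]
    by (rule lborel.emeasure_pair_measure_alt) (use assms sets_borel_pair in simp)
  also have "\<dots> = ennreal \<bar>c\<bar> * (\<integral>\<^sup>+y. emeasure lborel ((\<lambda>x. (x, y)) -` {(x, y). (y, t y + c * x) \<in> A}) \<partial>lborel)"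
    unfolding slice
    by (intro nn_integral_cmult) (use lborel_pair.measurable_emeasure_Pair2[OF B] in simp)
  also have "\<dots> = ennreal \<bar>c\<bar> * emeasure lborel {(x, y). (y, t y + c * x) \<in> A}"
    unfolding lborel_prod[symmetric] lborel_pair.emeasure_pair_measure_alt2[OF B] ..
  finally show ?thesis .
qed

lemma emeasure_swap:
  fixes A :: "(real \<times> real) set"
  assumes A[measurable]: "A \<in> sets borel"
  shows "emeasure lborel {(x, y). (y, x) \<in> A} = emeasure lborel A"
  using emeasure_shear[OF A, of "\<lambda>_. 0" 1] by simp


section \<open>Antiderivatives\<close>

lemma has_real_derivative_mult_abs:
  "((\<lambda>x::real. x * \<bar>x\<bar> / 2) has_real_derivative \<bar>x\<bar>) (at x)"
proof (cases "x = 0")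
  case True
  have "((\<lambda>h::real. \<bar>h\<bar> / 2) \<longlongrightarrow> 0) (at 0)"
    by (intro tendsto_eq_intros) auto
  then have "((\<lambda>h::real. h * \<bar>h\<bar> / 2 / h) \<longlongrightarrow> 0) (at 0)"
    by (rule Lim_transform_eventually) (auto simp: eventually_at_filter)
  with True show ?thesis
    by (simp add: has_field_derivative_iff)
next
  case False
  have "((\<lambda>y. sgn x * y\<^sup>2 / 2) has_real_derivative \<bar>x\<bar>) (at x)"
    by (auto intro!: derivative_eq_intros simp: abs_sgn)
  moreover have "open {y. 0 < sgn x * y}"
    by (intro open_Collect_less continuous_intros)
  moreover have "x \<in> {y. 0 < sgn x * y}"
    using False by (auto simp: sgn_if)
  moreover have "sgn x * y\<^sup>2 / 2 = y * \<bar>y\<bar> / 2"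
    if "y \<in> {y. 0 < sgn x * y}" for y
    using that by (auto simp: sgn_if power2_eq_square split: if_splits)
  ultimately show ?thesis
    by (rule has_field_derivative_transform_within_open)
qed

lemma has_real_derivative_sqrt_primitive:
  fixes c :: real
  assumes "0 < c"
  shows "((\<lambda>x. x * sqrt (x\<^sup>2 + c) / 2 + c / 2 * ln (x + sqrt (x\<^sup>2 + c))) has_real_derivative
    sqrt (x\<^sup>2 + c)) (at x)"
proof -
  define R where "R x = sqrt (x\<^sup>2 + c)" for x
  have pos: "0 < x\<^sup>2 + c"
    using assms by (intro add_nonneg_pos) auto
  then have r: "0 < R x" "(R x)\<^sup>2 = x\<^sup>2 + c"
    by (simp_all add: R_def)
  have "\<bar>x\<bar> < R x"
    using assms real_sqrt_less_mono[of "x\<^sup>2" "x\<^sup>2 + c"] by (simp add: R_def)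
  then have xr: "0 < x + R x"
    by auto
  have R: "(R has_real_derivative x / R x) (at x)"
    unfolding R_def[abs_def] using pos by (auto intro!: derivative_eq_intros simp: field_simps)
  have "((\<lambda>x. x * R x / 2 + c / 2 * ln (x + R x)) has_real_derivative
      (R x + x * (x / R x)) / 2 + c / 2 * ((1 + x / R x) / (x + R x))) (at x)"
    using DERIV_add[OF DERIV_cdivide[OF DERIV_mult[OF DERIV_ident R], where c = 2]
        DERIV_cmult[OF DERIV_chain2[OF DERIV_ln_divide[OF xr] DERIV_add[OF DERIV_ident R]],
          where c = "c / 2"]]
    by (simp add: mult.commute)
  moreover have "(1 + x / R x) / (x + R x) = 1 / R x"
  proof -
    have "1 + x / R x = (x + R x) / R x"
      using r by (simp add: field_simps)
    then show ?thesis
      using xr by simp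
  qed
  moreover have "(R x + x * (x / R x)) / 2 + c / 2 * (1 / R x) = R x"
    using r by (simp add: field_simps power2_eq_square)
  ultimately show ?thesis
    by (simp only: R_def)
qed

section \<open>The stick triangle and its medial triangle\<close>

lemma stick_triangle_iff:
  "(x, y) \<in> stick_triangle \<longleftrightarrow> 0 \<le> y \<and> y \<le> sqrt 3 * (1 + x) \<and> y \<le> sqrt 3 * (1 - x)"
proof
  assume b: "0 \<le> y \<and> y \<le> sqrt 3 * (1 + x) \<and> y \<le> sqrt 3 * (1 - x)"
  define w where "w = y / sqrt 3"
  have y: "y = sqrt 3 * w"
    by (simp add: w_def)
  have w: "0 \<le> w" "w \<le> 1 + x" "w \<le> 1 - x"
    using b by (auto simp: y zero_le_mult_iff)
  have "(x, y) = ((1 + x - w) / 2) *\<^sub>R (1, 0) + ((1 - x - w) / 2) *\<^sub>R (-1, 0) + w *\<^sub>R (0, sqrt 3)"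
    by (simp add: y field_simps)
  moreover have "(1 + x - w) / 2 + (1 - x - w) / 2 + w = 1"
    by (simp add: field_simps)
  ultimately show "(x, y) \<in> stick_triangle"
    using w unfolding stick_triangle_def convex_hull_3 by fastforce
qed (use stick_triangle_bounds in blast)

lemma sets_stick_triangle: "stick_triangle \<in> sets borel"
  unfolding stick_triangle_def
  by (intro borel_closed compact_imp_closed finite_imp_compact_convex_hull) auto

lemma emeasure_stick_triangle: "emeasure lborel stick_triangle = ennreal (sqrt 3)"
proof -
  have k: "sqrt 3 * (1 - \<bar>x\<bar>) = min (sqrt 3 * (1 + x)) (sqrt 3 * (1 - x))" for x
    by (auto simp: min_def abs_if)
  define F where "F x = sqrt 3 * (x - x * \<bar>x\<bar> / 2)" for x :: real
  have "emeasure lborel stick_triangle = ennreal (F 1 - F (-1))"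
  proof (rule emeasure_between_graphs[OF sets_stick_triangle,
        where a = "-1" and b = 1 and F = F and f = "\<lambda>_. 0" and g = "\<lambda>x. sqrt 3 * (1 - \<bar>x\<bar>)"])
    show "(F has_real_derivative sqrt 3 * (1 - \<bar>x\<bar>) - 0) (at x)" for x
      unfolding F_def
      using DERIV_cmult[OF DERIV_diff[OF DERIV_ident has_real_derivative_mult_abs]] by simp
  qed (auto simp: stick_triangle_iff k mult_le_0_iff)
  then show ?thesis
    by (simp add: F_def)
qed

lemma emeasure_medial_triangle:
  "emeasure lborel {(x, y). sqrt 3 * \<bar>x\<bar> < y \<and> y < sqrt 3 / 2} = ennreal (sqrt 3 / 4)"
proof -
  define F where "F x = sqrt 3 * (x / 2 - x * \<bar>x\<bar> / 2)" for x :: real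
  have "open {(x, y). sqrt 3 * \<bar>x\<bar> < y \<and> y < sqrt 3 / 2}"
    unfolding case_prod_beta by (intro open_Collect_conj open_Collect_less continuous_intros)
  then have "emeasure lborel {(x, y). sqrt 3 * \<bar>x\<bar> < y \<and> y < sqrt 3 / 2} = ennreal (F (1/2) - F (-1/2))"
  proof (intro emeasure_between_graphs[
        where a = "-1/2" and b = "1/2" and F = F and f = "\<lambda>x. sqrt 3 * \<bar>x\<bar>" and g = "\<lambda>x. sqrt 3 / 2"])
    show "(F has_real_derivative sqrt 3 / 2 - sqrt 3 * \<bar>x\<bar>) (at x)" for x
      unfolding F_def
      using DERIV_cmult[OF DERIV_diff[OF DERIV_cdivide[OF DERIV_ident]
            has_real_derivative_mult_abs]]
      by (simp add: right_diff_distrib)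
  qed (auto simp: mult_le_cancel_left_pos[of "sqrt 3" _ "1/2", simplified]
      mult_le_cancel_left_pos[of "sqrt 3" "1/2", simplified])
  then show ?thesis
    by (simp add: F_def)
qed

section \<open>Exchanging the pieces\<close>

text \<open>A predicate on the three pieces, read through the linear formulas for the distances, which
  extend the pieces from the stick triangle to signed distances on the whole plane.\<close>

definition piece_region :: "(real \<Rightarrow> real \<Rightarrow> real \<Rightarrow> bool) \<Rightarrow> point set" where
  "piece_region P = {(x, y). P y ((sqrt 3 * (1 + x) - y) / 2) ((sqrt 3 * (1 - x) - y) / 2)}"

lemma sets_piece_region:
  assumes "{(a, b, c). P a b c} \<in> sets borel"
  shows "piece_region P \<in> sets borel"
proof -
  have "(\<lambda>Q. (snd Q, (sqrt 3 * (1 + fst Q) - snd Q) / 2, (sqrt 3 * (1 - fst Q) - snd Q) / 2))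
      -` {(a, b, c). P a b c} \<in> sets borel"
    by (intro measurable_sets_borel[OF _ assms] borel_measurable_continuous_onI continuous_intros) auto
  then show ?thesis
    by (simp add: piece_region_def vimage_def case_prod_unfold)
qed

lemma sets_swap_coordinates:
  assumes P: "{(a :: real, b :: real, c :: real). P a b c} \<in> sets borel"
  shows "{(a, b, c). P b a c} \<in> sets borel" and "{(a, b, c). P c b a} \<in> sets borel"
proof -
  have "(\<lambda>Q. (fst (snd Q), fst Q, snd (snd Q))) -` {(a, b, c). P a b c} \<in> sets borel"
    "(\<lambda>Q. (snd (snd Q), fst (snd Q), fst Q)) -` {(a, b, c). P a b c} \<in> sets borel"
    by (intro measurable_sets_borel[OF _ P] borel_measurable_continuous_onI continuous_intros)+
  then show "{(a, b, c). P b a c} \<in> sets borel" "{(a, b, c). P c b a} \<in> sets borel"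
    by (simp_all add: vimage_def case_prod_unfold)
qed

text \<open>In the coordinates formed by \<open>\<alpha>\<close> and one other piece, exchanging these two pieces is the
  coordinate swap, and passing to these coordinates scales all areas by the same factor
  \<open>\<surd>3/2\<close>.\<close>

lemma emeasure_piece_region_swap:
  assumes P: "{(a, b, c). P a b c} \<in> sets borel"
  shows "emeasure lborel (piece_region (\<lambda>a b c. P b a c)) = emeasure lborel (piece_region P)" (is ?ab)
    and "emeasure lborel (piece_region (\<lambda>a b c. P c b a)) = emeasure lborel (piece_region P)" (is ?ac)
proof -
  define A where "A = {(u, v). P u v (sqrt 3 - u - v)}"
  have "(\<lambda>Q. (fst Q, snd Q, sqrt 3 - fst Q - snd Q)) -` {(a, b, c). P a b c} \<in> sets borel"
    by (intro measurable_sets_borel[OF _ P] borel_measurable_continuous_onI continuous_intros)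
  then have A: "A \<in> sets borel"
    by (simp add: A_def vimage_def case_prod_unfold)
  define B where "B = {(u, v). P u (sqrt 3 - u - v) v}"
  have "(\<lambda>Q. (fst Q, sqrt 3 - fst Q - snd Q, snd Q)) -` {(a, b, c). P a b c} \<in> sets borel"
    by (intro measurable_sets_borel[OF _ P] borel_measurable_continuous_onI continuous_intros)
  then have B: "B \<in> sets borel"
    by (simp add: B_def vimage_def case_prod_unfold)
  have swap: "{(u, v). (v, u) \<in> C} \<in> sets borel" if "C \<in> sets borel" for C :: "(real \<times> real) set"
  proof -
    have "prod.swap -` C \<in> sets borel"
      unfolding prod.swap_def
      by (intro measurable_sets_borel[OF _ that] borel_measurable_continuous_onI continuous_intros)
    then show ?thesis
      by (simp add: vimage_def prod.swap_def case_prod_unfold)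
  qed
  have t: "(\<lambda>y. (sqrt 3 - y) / 2) \<in> borel_measurable borel"
    by simp
  have shear: "emeasure lborel {(x, y). (y, (sqrt 3 - y) / 2 + c * x) \<in> C}
      = emeasure lborel {(x, y). (y, (sqrt 3 - y) / 2 + c * x) \<in> {(u, v). (v, u) \<in> C}}"
    if C: "C \<in> sets borel" and c: "\<bar>c\<bar> = sqrt 3 / 2" for C c
  proof -
    have "c \<noteq> 0"
      using c by auto
    have "ennreal \<bar>c\<bar> * emeasure lborel {(x, y). (y, (sqrt 3 - y) / 2 + c * x) \<in> C}
        = emeasure lborel C"
      using emeasure_shear[OF C t \<open>c \<noteq> 0\<close>] by (rule sym)
    also have "\<dots> = emeasure lborel {(u, v). (v, u) \<in> C}"
      using emeasure_swap[OF C] by (rule sym)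
    also have "\<dots> = ennreal \<bar>c\<bar>
        * emeasure lborel {(x, y). (y, (sqrt 3 - y) / 2 + c * x) \<in> {(u, v). (v, u) \<in> C}}"
      by (rule emeasure_shear[OF swap[OF C] t \<open>c \<noteq> 0\<close>])
    finally have "ennreal \<bar>c\<bar> * emeasure lborel {(x, y). (y, (sqrt 3 - y) / 2 + c * x) \<in> C}
      = ennreal \<bar>c\<bar> * emeasure lborel {(x, y). (y, (sqrt 3 - y) / 2 + c * x) \<in> {(u, v). (v, u) \<in> C}}" .
    then show ?thesis
      using c by (subst (asm) ennreal_mult_cancel_left) auto
  qed
  have coords: "(sqrt 3 - y) / 2 + sqrt 3 / 2 * x = (sqrt 3 * (1 + x) - y) / 2"
    "(sqrt 3 - y) / 2 + (- (sqrt 3 / 2)) * x = (sqrt 3 * (1 - x) - y) / 2"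
    "sqrt 3 - y - (sqrt 3 * (1 + x) - y) / 2 = (sqrt 3 * (1 - x) - y) / 2"
    "sqrt 3 - y - (sqrt 3 * (1 - x) - y) / 2 = (sqrt 3 * (1 + x) - y) / 2"
    "sqrt 3 - (sqrt 3 * (1 + x) - y) / 2 - y = (sqrt 3 * (1 - x) - y) / 2"
    "sqrt 3 - (sqrt 3 * (1 - x) - y) / 2 - y = (sqrt 3 * (1 + x) - y) / 2" for x y
    by (simp_all add: field_simps)
  have "piece_region P = {(x, y). (y, (sqrt 3 - y) / 2 + sqrt 3 / 2 * x) \<in> A}"
    "piece_region (\<lambda>a b c. P b a c)
      = {(x, y). (y, (sqrt 3 - y) / 2 + sqrt 3 / 2 * x) \<in> {(u, v). (v, u) \<in> A}}"
    unfolding piece_region_def A_def coords by (simp_all add: coords)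
  then show ?ab
    using shear[OF A, of "sqrt 3 / 2"] by simp
  have "piece_region P = {(x, y). (y, (sqrt 3 - y) / 2 + (- (sqrt 3 / 2)) * x) \<in> B}"
    "piece_region (\<lambda>a b c. P c b a)
      = {(x, y). (y, (sqrt 3 - y) / 2 + (- (sqrt 3 / 2)) * x) \<in> {(u, v). (v, u) \<in> B}}"
    unfolding piece_region_def B_def coords by (simp_all add: coords)
  then show ?ac
    using shear[OF B, of "- (sqrt 3 / 2)"] by simp
qed

section \<open>The region where the first piece is shortest\<close>

lemma emeasure_min_piece_region:
  assumes P: "{(a, b, c). P a b c} \<in> sets borel"
    and lower: "\<And>a b c. 0 \<le> a \<Longrightarrow> a < b \<Longrightarrow> a < c \<Longrightarrow> b\<^sup>2 + c\<^sup>2 < 5 * a\<^sup>2 \<Longrightarrow> P a b c"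
    and upper: "\<And>a b c. P a b c \<Longrightarrow> 0 \<le> a \<and> a \<le> b \<and> a \<le> c \<and> b\<^sup>2 + c\<^sup>2 < 5 * a\<^sup>2"
  shows "emeasure lborel (piece_region P) = ennreal ((1 / 3 - 5 / 9 * ln (8 / 5)) / sqrt 3)"
proof -
  define f where "f x = (sqrt (x\<^sup>2 + 10 / 9) - 1 / 3) / sqrt 3" for x :: real
  define g where "g x = (1 - \<bar>x\<bar>) / sqrt 3" for x :: real
  define G where "G x = x * sqrt (x\<^sup>2 + 10 / 9) / 2 + 10 / 9 / 2 * ln (x + sqrt (x\<^sup>2 + 10 / 9))" for x :: real
  define F where "F x = (4 / 3 * x - x * \<bar>x\<bar> / 2 - G x) / sqrt 3" for x
  have diff: "g x - f x = (4 / 3 - \<bar>x\<bar> - sqrt (x\<^sup>2 + 10 / 9)) / sqrt 3" for x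
    by (simp add: f_def g_def flip: diff_divide_distrib)
  \<comment> \<open>The graph of \<open>g\<close> is the lower envelope of the lines \<open>\<alpha> = \<beta>\<close> and \<open>\<alpha> = \<gamma>\<close>.\<close>
  have below: "y < (sqrt 3 * (1 + x) - y) / 2 \<and> y < (sqrt 3 * (1 - x) - y) / 2 \<longleftrightarrow> y < g x"
    and below': "y \<le> (sqrt 3 * (1 + x) - y) / 2 \<and> y \<le> (sqrt 3 * (1 - x) - y) / 2 \<longleftrightarrow> y \<le> g x"
    for x y :: real
  proof -
    define z where "z = sqrt 3 * y"
    have y: "y = sqrt 3 * (z / 3)"
      by (simp add: z_def)
    have 1: "(sqrt 3 * (1 + x) - y) / 2 = sqrt 3 * ((1 + x - z / 3) / 2)"
      "(sqrt 3 * (1 - x) - y) / 2 = sqrt 3 * ((1 - x - z / 3) / 2)"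
      by (simp_all add: y field_simps)
    have 2: "y < g x \<longleftrightarrow> z < 1 - \<bar>x\<bar>" "y \<le> g x \<longleftrightarrow> z \<le> 1 - \<bar>x\<bar>"
      by (simp_all add: g_def z_def field_simps)
    show "y < (sqrt 3 * (1 + x) - y) / 2 \<and> y < (sqrt 3 * (1 - x) - y) / 2 \<longleftrightarrow> y < g x"
      unfolding 1 2 by (subst (1 2) y) auto
    show "y \<le> (sqrt 3 * (1 + x) - y) / 2 \<and> y \<le> (sqrt 3 * (1 - x) - y) / 2 \<longleftrightarrow> y \<le> g x"
      unfolding 1 2 by (subst (1 2) y) auto
  qed
  \<comment> \<open>The branch of the hyperbola \<open>\<beta>\<^sup>2 + \<gamma>\<^sup>2 = 5\<alpha>\<^sup>2\<close> with \<open>y \<ge> 0\<close> is the graph of \<open>f\<close>.\<close>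
  have above: "((sqrt 3 * (1 + x) - y) / 2)\<^sup>2 + ((sqrt 3 * (1 - x) - y) / 2)\<^sup>2 < 5 * y\<^sup>2 \<longleftrightarrow> f x < y"
    if "0 \<le> y" for x y :: real
  proof -
    have s3: "sqrt 3 * (sqrt 3 * t) = 3 * t" for t
      by (simp flip: mult.assoc)
    have "((sqrt 3 * (1 + x) - y) / 2)\<^sup>2 + ((sqrt 3 * (1 - x) - y) / 2)\<^sup>2 - 5 * y\<^sup>2
        = 3 / 2 * ((x\<^sup>2 + 10 / 9) - (sqrt 3 * y + 1 / 3)\<^sup>2)"
      by (simp add: power2_eq_square field_simps s3)
    then have "((sqrt 3 * (1 + x) - y) / 2)\<^sup>2 + ((sqrt 3 * (1 - x) - y) / 2)\<^sup>2 < 5 * y\<^sup>2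
        \<longleftrightarrow> x\<^sup>2 + 10 / 9 < (sqrt 3 * y + 1 / 3)\<^sup>2"
      by auto
    also have "\<dots> \<longleftrightarrow> sqrt (x\<^sup>2 + 10 / 9) < sqrt 3 * y + 1 / 3"
      using that real_sqrt_less_iff[of "x\<^sup>2 + 10 / 9" "(sqrt 3 * y + 1 / 3)\<^sup>2"] by simp
    also have "\<dots> \<longleftrightarrow> f x < y"
      by (auto simp: f_def field_simps)
    finally show ?thesis .
  qed
  have f_nonneg: "0 \<le> f x" for x
  proof -
    have "1 / 3 \<le> sqrt (x\<^sup>2 + 10 / 9)"
      by (rule real_le_rsqrt) (simp add: power2_eq_square)
    then show ?thesis by (simp add: f_def)
  qed
  \<comment> \<open>The graphs of \<open>f\<close> and \<open>g\<close> cross at \<open>x = \<plusminus>1/4\<close> only.\<close>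
  have cross: "sqrt (x\<^sup>2 + 10 / 9) \<le> 4 / 3 - \<bar>x\<bar> \<longleftrightarrow> \<bar>x\<bar> \<le> 1 / 4" for x :: real
  proof -
    have "(4 / 3 - \<bar>x\<bar>)\<^sup>2 = x\<^sup>2 + 10 / 9 + 8 / 3 * (1 / 4 - \<bar>x\<bar>)"
      by (simp add: power2_eq_square field_simps)
    then have "\<bar>x\<bar> \<le> 1 / 4 \<longleftrightarrow> x\<^sup>2 + 10 / 9 \<le> (4 / 3 - \<bar>x\<bar>)\<^sup>2"
      by auto
    also have "\<dots> \<longleftrightarrow> sqrt (x\<^sup>2 + 10 / 9) \<le> \<bar>4 / 3 - \<bar>x\<bar>\<bar>"
      by (metis real_sqrt_abs real_sqrt_le_iff)
    finally have *: "\<bar>x\<bar> \<le> 1 / 4 \<longleftrightarrow> sqrt (x\<^sup>2 + 10 / 9) \<le> \<bar>4 / 3 - \<bar>x\<bar>\<bar>" .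
    have "0 \<le> sqrt (x\<^sup>2 + 10 / 9)" by simp
    with * show ?thesis
      by linarith
  qed
  have "emeasure lborel (piece_region P) = ennreal (F (1 / 4) - F (- (1 / 4)))"
  proof (rule emeasure_between_graphs[OF sets_piece_region[OF P],
        where a = "- (1 / 4)" and b = "1 / 4" and F = F and f = f and g = g])
    show "{(x, y). f x < y \<and> y < g x} \<subseteq> piece_region P"
    proof clarify
      fix x y assume y: "f x < y" "y < g x"
      then have "0 \<le> y"
        using f_nonneg[of x] by linarith
      with y show "(x, y) \<in> piece_region P"
        unfolding piece_region_def using above[of y x] below[of y x] by (auto intro!: lower)
    qed
    show "piece_region P \<subseteq> {(x, y). f x \<le> y \<and> y \<le> g x}"
    proof clarify
      fix x y assume "(x, y) \<in> piece_region P"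
      then have "P y ((sqrt 3 * (1 + x) - y) / 2) ((sqrt 3 * (1 - x) - y) / 2)"
        by (simp add: piece_region_def)
      from upper[OF this] show "f x \<le> y \<and> y \<le> g x"
        using above[of y x] below'[of y x] by auto
    qed
    show "f x \<le> g x" if "- (1 / 4) \<le> x" "x \<le> 1 / 4" for x
      unfolding f_def g_def using cross[of x] that by (intro divide_right_mono) auto
    show "g x \<le> f x" if "x < - (1 / 4) \<or> 1 / 4 < x" for x
    proof -
      have "\<not> \<bar>x\<bar> \<le> 1 / 4"
        using that by auto
      then show ?thesis
        unfolding f_def g_def using cross[of x] by (intro divide_right_mono) auto
    qed
    show "(F has_real_derivative g x - f x) (at x)" for x
      unfolding F_def G_def diff
      using DERIV_cdivide[OF DERIV_diff[OF DERIV_diff[OF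
              DERIV_cmult[OF DERIV_ident, where c = "4 / 3"] has_real_derivative_mult_abs]
            has_real_derivative_sqrt_primitive[of "10 / 9"]], where c = "sqrt 3"]
      by simp
  qed (auto simp: f_def[abs_def] g_def[abs_def])
  also have "F (1 / 4) - F (- (1 / 4)) = (1 / 3 - 5 / 9 * ln (8 / 5)) / sqrt 3"
  proof -
    have r: "sqrt (169 / 144) = 13 / 12"
      by (rule real_sqrt_unique) (simp_all add: power2_eq_square)
    have G: "G (1 / 4) = 13 / 96 + 5 / 9 * ln (4 / 3)" "G (- (1 / 4)) = - 13 / 96 + 5 / 9 * ln (5 / 6)"
      by (simp_all add: G_def power2_eq_square r)
    have "ln (8 / 5 :: real) = ln (4 / 3) - ln (5 / 6)"
      using ln_div[of "4 / 3 :: real" "5 / 6"] by simp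
    then show ?thesis
      unfolding F_def diff_divide_distrib[symmetric] G by (simp add: algebra_simps)
  qed
  finally show ?thesis .
qed


section \<open>The two events as planar regions\<close>

lemma mem_piece_region_iff:
  assumes "(x, y) \<in> stick_triangle"
  shows "(x, y) \<in> piece_region P \<longleftrightarrow> P (alpha (x, y)) (beta (x, y)) (gamma (x, y))"
  by (simp add: piece_region_def alpha_eq[OF assms] beta_eq[OF assms] gamma_eq[OF assms])

lemma stick_triangle_eq_piece_region: "stick_triangle = piece_region (\<lambda>a b c. 0 \<le> a \<and> 0 \<le> b \<and> 0 \<le> c)"
  by (auto simp: piece_region_def stick_triangle_iff)

text \<open>As the pieces add up to \<open>\<surd>3\<close>, the triangle inequalities say that each is below \<open>\<surd>3/2\<close>.\<close>

lemma median_event_eq: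
  "{Q \<in> stick_triangle. \<exists>A B C. triangle A B C \<and> median_lengths A B C (alpha Q) (beta Q) (gamma Q)}
    = {(x, y). sqrt 3 * \<bar>x\<bar> < y \<and> y < sqrt 3 / 2}"
proof -
  have "(\<exists>A B C. triangle A B C \<and> median_lengths A B C a b c) \<longleftrightarrow> a < b + c \<and> b < c + a \<and> c < a + b"
    for a b c
    by (metis triangle_iff_medians medians_exist)
  then have "{Q \<in> stick_triangle. \<exists>A B C. triangle A B C
        \<and> median_lengths A B C (alpha Q) (beta Q) (gamma Q)}
      = {Q \<in> stick_triangle. alpha Q < beta Q + gamma Q \<and> beta Q < gamma Q + alpha Q
        \<and> gamma Q < alpha Q + beta Q}"
    by simp
  also have "\<dots> = {(x, y). sqrt 3 * \<bar>x\<bar> < y \<and> y < sqrt 3 / 2}"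
  proof (intro set_eqI, clarify)
    fix x y :: real
    have x: "sqrt 3 * \<bar>x\<bar> = \<bar>sqrt 3 * x\<bar>"
      by (simp add: abs_mult)
    have T: "(x, y) \<in> stick_triangle \<longleftrightarrow> 0 \<le> y \<and> y \<le> sqrt 3 + sqrt 3 * x \<and> y \<le> sqrt 3 - sqrt 3 * x"
      by (simp add: stick_triangle_iff algebra_simps)
    have linear: "y < (k + s - y) / 2 + (k - s - y) / 2 \<and> (k + s - y) / 2 < (k - s - y) / 2 + y
        \<and> (k - s - y) / 2 < y + (k + s - y) / 2 \<longleftrightarrow> \<bar>s\<bar> < y \<and> y < k / 2" for k s :: real
      by (auto simp: abs_less_iff field_simps)
    show "(x, y) \<in> {Q \<in> stick_triangle. alpha Q < beta Q + gamma Q \<and> beta Q < gamma Q + alpha Q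
        \<and> gamma Q < alpha Q + beta Q} \<longleftrightarrow> (x, y) \<in> {(x, y). sqrt 3 * \<bar>x\<bar> < y \<and> y < sqrt 3 / 2}"
    proof (cases "(x, y) \<in> stick_triangle")
      case True
      have pieces: "alpha (x, y) = y" "beta (x, y) = (sqrt 3 + sqrt 3 * x - y) / 2"
        "gamma (x, y) = (sqrt 3 - sqrt 3 * x - y) / 2"
        by (simp_all add: alpha_eq[OF True] beta_eq[OF True] gamma_eq[OF True] distrib_left
            right_diff_distrib)
      show ?thesis
        using True by (simp only: mem_Collect_eq case_prod_conv pieces x linear simp_thms)
    next
      case False
      then show ?thesis
        unfolding T by (auto simp only: mem_Collect_eq case_prod_conv T x abs_less_iff)
    qed
  qed
  finally show ?thesis .
qed

lemma acute_event_eq: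
  "{Q \<in> stick_triangle. \<exists>A B C. triangle A B C \<and> median_lengths A B C (alpha Q) (beta Q) (gamma Q)
      \<and> acute A B C}
    = piece_region (\<lambda>a b c. 0 \<le> a \<and> 0 \<le> b \<and> 0 \<le> c \<and>
        b\<^sup>2 + c\<^sup>2 < 5 * a\<^sup>2 \<and> c\<^sup>2 + a\<^sup>2 < 5 * b\<^sup>2 \<and> a\<^sup>2 + b\<^sup>2 < 5 * c\<^sup>2)"
    (is "?E = piece_region ?P")
proof -
  have ex: "(\<exists>A B C. triangle A B C \<and> median_lengths A B C a b c \<and> acute A B C) \<longleftrightarrow> ?P a b c"
    if "0 \<le> a" "0 \<le> b" "0 \<le> c" for a b c
  proof
    assume "\<exists>A B C. triangle A B C \<and> median_lengths A B C a b c \<and> acute A B C"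
    then show "?P a b c"
      using acute_iff_medians that by blast
  next
    assume P: "?P a b c"
    have "a < b + c" "b < c + a" "c < a + b"
      using P acute_medians_imp_triangle[of a b c] acute_medians_imp_triangle[of b c a]
        acute_medians_imp_triangle[of c a b] by auto
    moreover from this obtain A B C where "median_lengths A B C a b c"
      using medians_exist by blast
    ultimately show "\<exists>A B C. triangle A B C \<and> median_lengths A B C a b c \<and> acute A B C"
      using P triangle_iff_medians acute_iff_medians by blast
  qed
  have "Q \<in> ?E \<longleftrightarrow> Q \<in> piece_region ?P" for Q
  proof (cases "Q \<in> stick_triangle")
    case True
    then have "0 \<le> alpha Q" "0 \<le> beta Q" "0 \<le> gamma Q"
      by (auto simp: alpha_def beta_def gamma_def infdist_nonneg)
    with True show ?thesis
      using ex mem_piece_region_iff[of "fst Q" "snd Q" ?P] by simp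
  next
    case False
    then show ?thesis
      by (auto simp: stick_triangle_eq_piece_region piece_region_def)
  qed
  then show ?thesis
    by blast
qed

section \<open>Areas and probabilities\<close>

lemma sets_min_predicate:
  "{(a, b, c :: real). 0 \<le> a \<and> a \<le> b \<and> a \<le> c \<and> b\<^sup>2 + c\<^sup>2 < 5 * a\<^sup>2} \<in> sets borel"
  "{(a, b, c :: real). 0 \<le> a \<and> a < b \<and> a \<le> c \<and> b\<^sup>2 + c\<^sup>2 < 5 * a\<^sup>2} \<in> sets borel"
  "{(a, b, c :: real). 0 \<le> a \<and> a < b \<and> a < c \<and> b\<^sup>2 + c\<^sup>2 < 5 * a\<^sup>2} \<in> sets borel"
proof -
  show "{(a, b, c :: real). 0 \<le> a \<and> a \<le> b \<and> a \<le> c \<and> b\<^sup>2 + c\<^sup>2 < 5 * a\<^sup>2} \<in> sets borel"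
    "{(a, b, c :: real). 0 \<le> a \<and> a < b \<and> a \<le> c \<and> b\<^sup>2 + c\<^sup>2 < 5 * a\<^sup>2} \<in> sets borel"
    "{(a, b, c :: real). 0 \<le> a \<and> a < b \<and> a < c \<and> b\<^sup>2 + c\<^sup>2 < 5 * a\<^sup>2} \<in> sets borel"
    unfolding case_prod_unfold Collect_conj_eq
    by (intro sets.Int borel_closed[OF closed_Collect_le] borel_open[OF open_Collect_less]
        continuous_intros)+
qed

lemma piece_region_disj: "piece_region (\<lambda>a b c. P a b c \<or> P' a b c) = piece_region P \<union> piece_region P'"
  by (auto simp: piece_region_def)

text \<open>When \<open>a\<close> is the smallest of three nonnegative numbers, \<open>b\<^sup>2 + c\<^sup>2 < 5a\<^sup>2\<close> implies the other two
  inequalities, so the region is the union of three parts indexed by the smallest piece.\<close>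

lemma acute_region:
  defines "acuteR \<equiv> piece_region (\<lambda>a b c. 0 \<le> a \<and> 0 \<le> b \<and> 0 \<le> c \<and>
      b\<^sup>2 + c\<^sup>2 < 5 * a\<^sup>2 \<and> c\<^sup>2 + a\<^sup>2 < 5 * b\<^sup>2 \<and> a\<^sup>2 + b\<^sup>2 < 5 * c\<^sup>2)" (is "_ \<equiv> piece_region ?P")
  shows "acuteR \<in> sets borel"
    and "emeasure lborel acuteR = ennreal (sqrt 3 * (1 / 3 - 5 / 9 * ln (8 / 5)))"
proof -
  \<comment> \<open>Ties for the smallest piece go to \<open>\<alpha>\<close> first and then to \<open>\<beta>\<close>, which makes the parts disjoint;
    this is why the three predicates differ in strictness.\<close>
  define N1 N2 N3 :: "real \<Rightarrow> real \<Rightarrow> real \<Rightarrow> bool"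
    where "N1 a b c \<longleftrightarrow> 0 \<le> a \<and> a \<le> b \<and> a \<le> c \<and> b\<^sup>2 + c\<^sup>2 < 5 * a\<^sup>2"
      and "N2 a b c \<longleftrightarrow> 0 \<le> a \<and> a < b \<and> a \<le> c \<and> b\<^sup>2 + c\<^sup>2 < 5 * a\<^sup>2"
      and "N3 a b c \<longleftrightarrow> 0 \<le> a \<and> a < b \<and> a < c \<and> b\<^sup>2 + c\<^sup>2 < 5 * a\<^sup>2" for a b c
  note N_defs = N1_def N2_def N3_def
  define q :: real where "q = (1 / 3 - 5 / 9 * ln (8 / 5)) / sqrt 3"
  have sets: "{(a, b, c). N1 a b c} \<in> sets borel" "{(a, b, c). N2 a b c} \<in> sets borel"
    "{(a, b, c). N3 a b c} \<in> sets borel"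
    unfolding N_defs by (rule sets_min_predicate)+
  have N: "emeasure lborel (piece_region N1) = ennreal q" "emeasure lborel (piece_region N2) = ennreal q"
    "emeasure lborel (piece_region N3) = ennreal q"
    unfolding q_def by (rule emeasure_min_piece_region[OF sets(1)] emeasure_min_piece_region[OF sets(2)]
        emeasure_min_piece_region[OF sets(3)]; simp add: N_defs)+
  define R1 R2 R3 where "R1 = piece_region N1" and "R2 = piece_region (\<lambda>a b c. N2 b a c)"
    and "R3 = piece_region (\<lambda>a b c. N3 c b a)"
  have eR: "emeasure lborel R1 = ennreal q" "emeasure lborel R2 = ennreal q" "emeasure lborel R3 = ennreal q"
    by (simp_all add: R1_def R2_def R3_def emeasure_piece_region_swap sets N)
  have P: "?P a b c \<longleftrightarrow> N1 a b c \<or> N2 b a c \<or> N3 c b a" for a b c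
  proof -
    have mono: "u\<^sup>2 \<le> v\<^sup>2" if "0 \<le> u" "u \<le> v" for u v :: real
      using that by (rule power_mono[rotated])
    show ?thesis
      unfolding N_defs using mono[of a b] mono[of a c] mono[of b a] mono[of b c] mono[of c a] mono[of c b]
      by (smt (verit))
  qed
  have acuteR: "acuteR = R1 \<union> (R2 \<union> R3)"
    unfolding acuteR_def P piece_region_disj R1_def R2_def R3_def ..
  have disj: "R1 \<inter> (R2 \<union> R3) = {}" "R2 \<inter> R3 = {}"
    by (auto simp: R1_def R2_def R3_def piece_region_def N_defs)
  have borel: "R1 \<in> sets borel" "R2 \<in> sets borel" "R3 \<in> sets borel"
    unfolding R1_def R2_def R3_def using sets by (auto intro: sets_piece_region sets_swap_coordinates)
  then show "acuteR \<in> sets borel"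
    unfolding acuteR by auto
  have "emeasure lborel acuteR = ennreal q + (ennreal q + ennreal q)"
    unfolding acuteR using disj borel by (simp add: plus_emeasure[symmetric] eR)
  also have "\<dots> = ennreal 3 * ennreal q"
  proof -
    have "(3 :: ennreal) = 1 + (1 + 1)"
      by simp
    then show ?thesis
      by (simp only: ennreal_numeral distrib_right mult_1)
  qed
  also have "\<dots> = ennreal (3 * q)"
    by (rule ennreal_mult'[symmetric]) simp
  also have "3 * q = sqrt 3 * (1 / 3 - 5 / 9 * ln (8 / 5))"
  proof -
    have "3 / sqrt 3 = sqrt 3"
      by (rule real_div_sqrt) simp
    then have "3 * (t / sqrt 3) = sqrt 3 * t" for t
      by (metis times_divide_eq_left times_divide_eq_right)
    then show ?thesis
      unfolding q_def .
  qed
  finally show "emeasure lborel acuteR = ennreal (sqrt 3 * (1 / 3 - 5 / 9 * ln (8 / 5)))" .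
qed

lemma measure_broken_stick:
  assumes "S \<subseteq> stick_triangle" "S \<in> sets borel" "emeasure lborel S = ennreal (sqrt 3 * p)" "0 \<le> p"
  shows "measure broken_stick S = p"
proof -
  have "measure broken_stick S = measure lborel (stick_triangle \<inter> S) / measure lborel stick_triangle"
    unfolding broken_stick_def
    by (rule measure_uniform_measure) (use assms in \<open>simp_all add: emeasure_stick_triangle\<close>)
  also have "stick_triangle \<inter> S = S"
    using assms by blast
  finally show ?thesis
    using assms by (simp add: measure_def emeasure_stick_triangle)
qed

text \<open>The eight terms of the series for the logarithm used here leave an error well below the
  gap of about \<open>2.5 * 10\<^sup>-\<^sup>1\<^sup>1\<close> between the rounding error of the decimal and its bound.\<close>

lemma probability_numerical_bound:
  "\<bar>(1 / 3 - 5 / 9 * ln (8 / 5)) - (0.0722202059 :: real)\<bar> < 1 / 10 ^ 10"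
  using ln_approx_bounds[of "8/5" 8]
  by (simp add: eval_nat_numeral)


theorem corollary1:
  shows "measure broken_stick
      {Q \<in> stick_triangle. \<exists>A B C. triangle A B C \<and>
         median_lengths A B C (alpha Q) (beta Q) (gamma Q)} = 1 / 4 \<and>
    measure broken_stick
      {Q \<in> stick_triangle. \<exists>A B C. triangle A B C \<and>
         median_lengths A B C (alpha Q) (beta Q) (gamma Q) \<and> acute A B C}
      = 1 / 3 - 5 / 9 * ln (8 / 5) \<and>
    \<bar>(1 / 3 - 5 / 9 * ln (8 / 5)) - (0.0722202059 :: real)\<bar> < 1 / 10 ^ 10"
    (is "measure broken_stick ?M = _ \<and> measure broken_stick ?A = _ \<and> _")
proof (intro conjI)
  show "\<bar>(1 / 3 - 5 / 9 * ln (8 / 5)) - (0.0722202059 :: real)\<bar> < 1 / 10 ^ 10"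
    by (rule probability_numerical_bound)
  show "measure broken_stick ?M = 1 / 4"
  proof (rule measure_broken_stick)
    have "open {(x, y). sqrt 3 * \<bar>x\<bar> < y \<and> y < sqrt 3 / 2}"
      unfolding case_prod_beta by (intro open_Collect_conj open_Collect_less continuous_intros)
    then show "?M \<in> sets borel"
      unfolding median_event_eq by (rule borel_open)
    show "emeasure lborel ?M = ennreal (sqrt 3 * (1 / 4))"
      unfolding median_event_eq emeasure_medial_triangle by simp
  qed auto
  show "measure broken_stick ?A = 1 / 3 - 5 / 9 * ln (8 / 5)"
  proof (rule measure_broken_stick)
    show "?A \<in> sets borel"
      unfolding acute_event_eq by (rule acute_region)
    show "emeasure lborel ?A = ennreal (sqrt 3 * (1 / 3 - 5 / 9 * ln (8 / 5)))"
      unfolding acute_event_eq by (rule acute_region)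
    show "0 \<le> 1 / 3 - 5 / 9 * ln (8 / 5 :: real)"
      using probability_numerical_bound by (simp add: abs_if split: if_splits)
  qed auto
qed

end
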